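(* Let $I=[a,b]$ with $a<b$ and let $0<r_1<r_2$. Then $\mathcal{BV}_{r_1}\subseteq\mathcal{BV}_{r_2}$.
   Context: For $r\in(0,\infty)$, $\mathcal{BV}_r$ is the class of all functions $f:I\to\mathbb{R}$ of $r$-bounded variation, i.e. such that the sums $\sum_{i=1}^n|f(x_i)-f(x_{i-1})|^r$ are bounded over all partitions $a=x_0<\cdots<x_n=b$ of $I$. *)

theory Defs
  imports "HOL-Analysis.Analysis"
begin

definition interval_partition :: "real \<Rightarrow> real \<Rightarrow> nat \<Rightarrow> (nat \<Rightarrow> real) \<Rightarrow> bool" where
  "interval_partition a b n x \<longleftrightarrow> x 0 = a \<and> x n = b \<and> (\<forall>i\<in>{1..n}. x (i - 1) < x i)"

text \<open>
  Functions from the interval to the reals are represented as extensional functions.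
  The exponent \<open>r\<close> is meant to be positive, so \<open>0 powr r = 0\<close> agrees with the usual convention.
\<close>

definition BV :: "real \<Rightarrow> real \<Rightarrow> real \<Rightarrow> (real \<Rightarrow> real) set" where
  "BV a b r = {f \<in> {a..b} \<rightarrow>\<^sub>E UNIV.
     bdd_above {(\<Sum>i=1..n. \<bar>f (x i) - f (x (i - 1))\<bar> powr r) | n x. interval_partition a b n x}}"

end

theory Submission
  imports Defs
begin

text \<open>Put \<open>p = r2 / r1\<close>, so \<open>p > 1\<close>. The \<open>r2\<close>-th power
  of an increment is the \<open>p\<close>-th power of its \<open>r1\<close>-th power, and for
  nonnegative terms a sum of \<open>p\<close>-th powers is at most the \<open>p\<close>-th power of
  the sum (\<open>sum_powr_le_powr_sum\<close>). A bound \<open>M\<close> on all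
  \<open>r1\<close>-sums thus gives the bound \<open>M powr p\<close> on all
  \<open>r2\<close>-sums.\<close>

text \<open>No term exceeds the total, so \<open>p - 1\<close> of the \<open>p\<close> factors of
  each term can be replaced by \<open>M\<close>; the remaining factors add up to at most
  \<open>M\<close>. Allowing any \<open>M\<close> above the sum makes the bound independent of the
  partition.\<close>

lemma sum_powr_le_powr_sum:
  fixes t :: "'i \<Rightarrow> real" and p M :: real
  assumes "finite A" and nonneg: "\<And>i. i \<in> A \<Longrightarrow> 0 \<le> t i"
    and "1 \<le> p" and le: "sum t A \<le> M"
  shows "(\<Sum>i\<in>A. t i powr p) \<le> M powr p"
proof -
  have "0 \<le> M"
    using sum_nonneg[of A t, OF nonneg] le by simp
  \<comment> \<open>This includes \<open>u = 0\<close>, even for \<open>p = 1\<close>, because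
    \<open>0 powr 0 = 0\<close> here.\<close>
  have split: "u powr p = u * u powr (p - 1)" if "0 \<le> u" for u :: real
    using that powr_add[of u 1 "p - 1"] by simp
  have "t i powr p \<le> t i * M powr (p - 1)" if "i \<in> A" for i
  proof -
    have "t i \<le> M"
      using member_le_sum[of i A t] that assms(1) nonneg le by force
    then show ?thesis
      using that nonneg \<open>1 \<le> p\<close> by (simp add: split mult_left_mono powr_mono2)
  qed
  then have "(\<Sum>i\<in>A. t i powr p) \<le> sum t A * M powr (p - 1)"
    by (simp add: sum_distrib_right sum_mono)
  also have "\<dots> \<le> M powr p"
    using le \<open>0 \<le> M\<close> by (simp add: split mult_right_mono)
  finally show ?thesis .
qed

theorem theorem3p9:
  fixes a b r1 r2 :: real
  assumes "a < b" and "0 < r1" and "r1 < r2"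
  shows "BV a b r1 \<subseteq> BV a b r2"
proof
  fix f assume f: "f \<in> BV a b r1"
  then obtain M where M: "(\<Sum>i=1..n. \<bar>f (x i) - f (x (i - 1))\<bar> powr r1) \<le> M"
    if "interval_partition a b n x" for n x
    unfolding BV_def bdd_above_def by blast
  have "(\<Sum>i=1..n. \<bar>f (x i) - f (x (i - 1))\<bar> powr r2) \<le> M powr (r2 / r1)"
    if "interval_partition a b n x" for n x
    \<comment> \<open>The terms \<open>t i\<close> are the increments raised to \<open>r1\<close>;
      since \<open>r1\<close> is nonzero, the exponents multiply to \<open>r2\<close>.\<close>
    using sum_powr_le_powr_sum[OF _ _ _ M[OF that], of "r2 / r1"] assms
    by (simp add: powr_powr)
  then show "f \<in> BV a b r2"
    using f unfolding BV_def bdd_above_def by blast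
qed

end
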